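(* Let $p=4m$, let $\Lambda=(\lambda_1,\ldots,\lambda_n)\subset\mathbb{H}^m\simeq\mathbb{R}^{p}$ satisfy $0\notin\operatorname{conv}\{\lambda_1,\ldots,\lambda_n\}$, let $\xi\in\mathbb{R}^p$ satisfy $\langle\lambda_j,\xi\rangle>0$ for all $j$, let $H_\xi\subset\mathbb{R}^p$ be a real hyperplane with $\mathbb{R}^p=H_\xi\oplus\mathbb{R}\xi$, and let $r>0$. For $U\in H_\xi$ and $q\in\mathbb{S}_r^{4n-1}$, let $\tau(U,q)$ be the unique real number with $\Phi_{U+\tau(U,q)\xi}(q)\in\mathbb{S}_r^{4n-1}$, and set $\Psi_U(q)=\Phi_{U+\tau(U,q)\xi}(q)$. Then the maps $\Psi_U$, $U\in H_\xi$, define a smooth action of the additive vector group $H_\xi$ on $\mathbb{S}_r^{4n-1}$. Its orbits are exactly the connected components of the intersections of the nonzero orbits of $\Phi$ with the sphere. If $q\in E_I^*\cap\mathbb{S}_r^{4n-1}$, then the trace leaf (the $\Psi$-orbit) through $q$ has dimension $\rho(I)-1$ and is diffeomorphic to $\mathbb{R}^{\rho(I)-1}$.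
   Context: $\mathbb{H}$ denotes the quaternions. The action of $T\in\mathbb{R}^p$ on $\mathbb{H}^n$ is $$\Phi_T(q_1,\ldots,q_n)=\big(e^{\langle\lambda_1,T\rangle}q_1,\ldots,e^{\langle\lambda_n,T\rangle}q_n\big),$$ and $\mathbb{S}_r^{4n-1}=\{q\in\mathbb{H}^n:\|q\|=r\}$. For $I\subset\{1,\ldots,n\}$, $$E_I^*=\{q\in\mathbb{H}^n:\ q_j=0\text{ for }j\notin I,\ q_j\ne0\text{ for }j\in I\},\qquad \rho(I)=\operatorname{rank}_{\mathbb R}\{\lambda_i:i\in I\}.$$ Existence and uniqueness of $\tau(U,q)$ follow from strict monotonicity of the norm along $\mathbb{R}\xi$-orbits. *)

theory Defs
  imports "HOL-Analysis.Analysis"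
begin

section \<open>Quaternions\<close>

datatype quat = Quat (qRe: real) (qI: real) (qJ: real) (qK: real)

lemma quat_eq_iff: "x = y \<longleftrightarrow> qRe x = qRe y \<and> qI x = qI y \<and> qJ x = qJ y \<and> qK x = qK y"
  by (cases x; cases y) simp

instantiation quat :: real_algebra_1
begin

definition zero_quat :: quat where "0 = Quat 0 0 0 0"
definition one_quat :: quat where "1 = Quat 1 0 0 0"
definition plus_quat :: "quat \<Rightarrow> quat \<Rightarrow> quat" where
  "x + y = Quat (qRe x + qRe y) (qI x + qI y) (qJ x + qJ y) (qK x + qK y)"
definition uminus_quat :: "quat \<Rightarrow> quat" where
  "- x = Quat (- qRe x) (- qI x) (- qJ x) (- qK x)"
definition minus_quat :: "quat \<Rightarrow> quat \<Rightarrow> quat" where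
  "x - y = Quat (qRe x - qRe y) (qI x - qI y) (qJ x - qJ y) (qK x - qK y)"
definition scaleR_quat :: "real \<Rightarrow> quat \<Rightarrow> quat" where
  "scaleR c x = Quat (c * qRe x) (c * qI x) (c * qJ x) (c * qK x)"
definition times_quat :: "quat \<Rightarrow> quat \<Rightarrow> quat" where
  "x * y = Quat
     (qRe x * qRe y - qI x * qI y - qJ x * qJ y - qK x * qK y)
     (qRe x * qI y + qI x * qRe y + qJ x * qK y - qK x * qJ y)
     (qRe x * qJ y - qI x * qK y + qJ x * qRe y + qK x * qI y)
     (qRe x * qK y + qI x * qJ y - qJ x * qI y + qK x * qRe y)"

instance
  by standard (simp_all add: quat_eq_iff zero_quat_def one_quat_def plus_quat_def
      uminus_quat_def minus_quat_def scaleR_quat_def times_quat_def algebra_simps)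

end

lemma quat_sel_simps [simp]:
  "qRe 0 = 0" "qI 0 = 0" "qJ 0 = 0" "qK 0 = 0"
  "qRe 1 = 1" "qI 1 = 0" "qJ 1 = 0" "qK 1 = 0"
  "qRe (x + y) = qRe x + qRe y" "qI (x + y) = qI x + qI y"
  "qJ (x + y) = qJ x + qJ y" "qK (x + y) = qK x + qK y"
  "qRe (- x) = - qRe x" "qI (- x) = - qI x" "qJ (- x) = - qJ x" "qK (- x) = - qK x"
  "qRe (x - y) = qRe x - qRe y" "qI (x - y) = qI x - qI y"
  "qJ (x - y) = qJ x - qJ y" "qK (x - y) = qK x - qK y"
  "qRe (c *\<^sub>R x) = c * qRe x" "qI (c *\<^sub>R x) = c * qI x"
  "qJ (c *\<^sub>R x) = c * qJ x" "qK (c *\<^sub>R x) = c * qK x"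
  by (simp_all add: zero_quat_def one_quat_def plus_quat_def uminus_quat_def
      minus_quat_def scaleR_quat_def)

instantiation quat :: real_inner
begin

definition inner_quat :: "quat \<Rightarrow> quat \<Rightarrow> real" where
  "inner x y = qRe x * qRe y + qI x * qI y + qJ x * qJ y + qK x * qK y"
definition norm_quat :: "quat \<Rightarrow> real" where
  "norm x = sqrt ((qRe x)\<^sup>2 + (qI x)\<^sup>2 + (qJ x)\<^sup>2 + (qK x)\<^sup>2)"
definition sgn_quat :: "quat \<Rightarrow> quat" where "sgn x = (x::quat) /\<^sub>R norm x"
definition dist_quat :: "quat \<Rightarrow> quat \<Rightarrow> real" where "dist x y = norm (x - y :: quat)"
definition uniformity_quat :: "(quat \<times> quat) filter" where
  "uniformity = (INF e\<in>{0 <..}. principal {(x, y :: quat). dist x y < e})"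
definition open_quat :: "quat set \<Rightarrow> bool" where
  "open (U :: quat set) \<longleftrightarrow> (\<forall>x\<in>U. eventually (\<lambda>(x', y). x' = x \<longrightarrow> y \<in> U) uniformity)"

instance
proof
  fix x y z :: quat and r :: real and U :: "quat set"
  show "inner x y = inner y x"
    by (simp add: inner_quat_def mult.commute)
  show "inner (x + y) z = inner x z + inner y z" "inner (scaleR r x) y = r * inner x y"
    by (simp_all add: inner_quat_def algebra_simps)
  show "0 \<le> inner x x"
    by (simp add: inner_quat_def)
  show "inner x x = 0 \<longleftrightarrow> x = 0"
    by (simp add: inner_quat_def quat_eq_iff add_nonneg_eq_0_iff)
  show "norm x = sqrt (inner x x)"
    by (simp add: inner_quat_def norm_quat_def power2_eq_square)
qed (rule sgn_quat_def dist_quat_def uniformity_quat_def open_quat_def)+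

end

instantiation quat :: real_normed_div_algebra
begin

definition inverse_quat :: "quat \<Rightarrow> quat" where
  "inverse x = Quat (qRe x) (- qI x) (- qJ x) (- qK x) /\<^sub>R (norm x)\<^sup>2"
definition divide_quat :: "quat \<Rightarrow> quat \<Rightarrow> quat" where
  "divide x y = x * inverse (y::quat)"

instance
proof
  fix x y :: quat
  show "inverse (0::quat) = 0"
    by (simp add: inverse_quat_def quat_eq_iff)
  show "divide x y = x * inverse y"
    by (rule divide_quat_def)
  define c where "c x = Quat (qRe x) (- qI x) (- qJ x) (- qK x)" for x
  have n2: "(norm x)\<^sup>2 = qRe x * qRe x + qI x * qI x + qJ x * qJ x + qK x * qK x" for x :: quat
    by (simp add: norm_quat_def power2_eq_square)
  have conj: "x * c x = (norm x)\<^sup>2 *\<^sub>R 1" "c x * x = (norm x)\<^sup>2 *\<^sub>R 1" for x :: quat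
    by (simp_all add: quat_eq_iff times_quat_def n2 c_def)
  show "x \<noteq> 0 \<Longrightarrow> inverse x * x = 1" "x \<noteq> 0 \<Longrightarrow> x * inverse x = 1"
    by (simp_all add: inverse_quat_def conj flip: c_def)
  have "c (x * y) = c y * c x"
    by (simp add: c_def times_quat_def algebra_simps)
  then have "(norm (x * y))\<^sup>2 *\<^sub>R (1 :: quat) = x * (y * c y) * c x"
    by (simp only: conj(1)[symmetric] mult.assoc)
  also have "\<dots> = ((norm x)\<^sup>2 * (norm y)\<^sup>2) *\<^sub>R 1"
    by (simp add: conj)
  finally have "(norm (x * y))\<^sup>2 = (norm x * norm y)\<^sup>2"
    by (simp add: power_mult_distrib)
  then show "norm (x * y) = norm x * norm y"
    by (rule power2_eq_imp_eq) simp_all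
qed

end

instantiation quat :: euclidean_space
begin

definition Basis_quat :: "quat set" where
  "Basis = {Quat 1 0 0 0, Quat 0 1 0 0, Quat 0 0 1 0, Quat 0 0 0 1}"

instance
proof
  show "(\<forall>u\<in>Basis. inner x u = 0) \<longleftrightarrow> x = 0" for x :: quat
    by (cases x) (simp add: Basis_quat_def inner_quat_def zero_quat_def)
qed (auto simp: Basis_quat_def inner_quat_def)

end

lemma DIM_quat: "DIM(quat) = 4"
  by (simp add: Basis_quat_def)

lemma DIM_quat_vec: "DIM(quat^'m) = 4 * CARD('m)"
  by (simp add: DIM_quat mult.commute)


section \<open>Smooth maps and submanifolds of Euclidean space\<close>

text \<open>\<open>Ck_on k S f\<close> is meant for open \<open>S\<close>: all iterated directional derivatives of \<open>f\<close> of
  order at most \<open>k\<close> exist (in the Frechet sense) and are continuous on \<open>S\<close>.\<close>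

primrec Ck_on ::
  "nat \<Rightarrow> 'a::euclidean_space set \<Rightarrow> ('a \<Rightarrow> 'b::euclidean_space) \<Rightarrow> bool" where
  "Ck_on 0 S f \<longleftrightarrow> continuous_on S f"
| "Ck_on (Suc k) S f \<longleftrightarrow>
     (\<forall>x\<in>S. f differentiable at x) \<and> (\<forall>v. Ck_on k S (\<lambda>x. frechet_derivative f (at x) v))"

text \<open>Smoothness on an arbitrary subset of Euclidean space is local extendability to a \<open>C\<^sup>\<infinity>\<close> map
  on an open set.  On an embedded submanifold this is smoothness for the manifold structure.\<close>

definition smooth_on ::
  "'a::euclidean_space set \<Rightarrow> ('a \<Rightarrow> 'b::euclidean_space) \<Rightarrow> bool" where
  "smooth_on X f \<longleftrightarrow>
     (\<forall>x\<in>X. \<exists>W g. open W \<and> x \<in> W \<and> (\<forall>k. Ck_on k W g) \<and> (\<forall>y\<in>X \<inter> W. g y = f y))"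

definition diffeomorphic ::
  "'a::euclidean_space set \<Rightarrow> 'b::euclidean_space set \<Rightarrow> bool" where
  "diffeomorphic X Y \<longleftrightarrow>
     (\<exists>f g. smooth_on X f \<and> f ` X \<subseteq> Y \<and> smooth_on Y g \<and> g ` Y \<subseteq> X \<and>
        (\<forall>x\<in>X. g (f x) = x) \<and> (\<forall>y\<in>Y. f (g y) = y))"

text \<open>The model of \<open>\<real>\<^sup>k\<close> is a \<open>k\<close>-dimensional linear subspace of the ambient space.  This lets
  \<open>k\<close> be a term, with \<open>k = 0\<close> allowed, and loses nothing: a subset of the ambient space that is
  a nonempty \<open>k\<close>-dimensional manifold has \<open>k\<close> at most the ambient dimension.\<close>

definition diffeomorphic_Rn :: "'a::euclidean_space set \<Rightarrow> nat \<Rightarrow> bool" where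
  "diffeomorphic_Rn X k \<longleftrightarrow> (\<exists>V::'a set. subspace V \<and> dim V = k \<and> diffeomorphic X V)"

definition smooth_submanifold :: "'a::euclidean_space set \<Rightarrow> nat \<Rightarrow> bool" where
  "smooth_submanifold X k \<longleftrightarrow>
     (\<forall>x\<in>X. \<exists>W. openin (top_of_set X) W \<and> x \<in> W \<and>
        (\<exists>(V::'a set) D. subspace V \<and> dim V = k \<and> openin (top_of_set V) D \<and> diffeomorphic W D))"

definition smooth_action ::
  "'a::euclidean_space set \<Rightarrow> 'b::euclidean_space set \<Rightarrow> ('a \<Rightarrow> 'b \<Rightarrow> 'b) \<Rightarrow> bool" where
  "smooth_action H M \<psi> \<longleftrightarrow>
     (\<forall>U\<in>H. \<forall>q\<in>M. \<psi> U q \<in> M) \<and>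
     (\<forall>q\<in>M. \<psi> 0 q = q) \<and>
     (\<forall>U\<in>H. \<forall>V\<in>H. \<forall>q\<in>M. \<psi> (U + V) q = \<psi> U (\<psi> V q)) \<and>
     smooth_on (H \<times> M) (\<lambda>(U, q). \<psi> U q)"


section \<open>The exponential action on quaternionic space\<close>

text \<open>\<open>\<real>\<^sup>p\<close> with \<open>p = 4m\<close> is \<open>\<bbbH>\<^sup>m\<close>, the type \<open>quat^'m\<close>, with its real Euclidean inner
  product (see \<open>DIM_quat_vec\<close>).\<close>

definition Phi :: "('n::finite \<Rightarrow> quat^'m::finite) \<Rightarrow> quat^'m \<Rightarrow> quat^'n \<Rightarrow> quat^'n" where
  "Phi \<Lambda> T q = (\<chi> j. of_real (exp (\<Lambda> j \<bullet> T)) * q $ j)"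

definition Phi_orbit :: "('n::finite \<Rightarrow> quat^'m::finite) \<Rightarrow> quat^'n \<Rightarrow> (quat^'n) set" where
  "Phi_orbit \<Lambda> q = range (\<lambda>T. Phi \<Lambda> T q)"

definition E_star :: "'n::finite set \<Rightarrow> (quat^'n) set" where
  "E_star I = {q. (\<forall>j. j \<notin> I \<longrightarrow> q $ j = 0) \<and> (\<forall>j\<in>I. q $ j \<noteq> 0)}"

definition rho :: "('n::finite \<Rightarrow> quat^'m::finite) \<Rightarrow> 'n set \<Rightarrow> nat" where
  "rho \<Lambda> I = dim (\<Lambda> ` I)"

definition real_hyperplane :: "'a::euclidean_space set \<Rightarrow> bool" where
  "real_hyperplane H \<longleftrightarrow> subspace H \<and> dim H = DIM('a) - 1"

definition tau ::
  "('n::finite \<Rightarrow> quat^'m::finite) \<Rightarrow> quat^'m \<Rightarrow> real \<Rightarrow> quat^'m \<Rightarrow> quat^'n \<Rightarrow> real" where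
  "tau \<Lambda> \<xi> r U q = (THE t. Phi \<Lambda> (U + t *\<^sub>R \<xi>) q \<in> sphere 0 r)"

definition Psi ::
  "('n::finite \<Rightarrow> quat^'m::finite) \<Rightarrow> quat^'m \<Rightarrow> real \<Rightarrow> quat^'m \<Rightarrow> quat^'n \<Rightarrow> quat^'n" where
  "Psi \<Lambda> \<xi> r U q = Phi \<Lambda> (U + tau \<Lambda> \<xi> r U q *\<^sub>R \<xi>) q"

definition Psi_orbit ::
  "('n::finite \<Rightarrow> quat^'m::finite) \<Rightarrow> quat^'m \<Rightarrow> (quat^'m) set \<Rightarrow> real \<Rightarrow> quat^'n \<Rightarrow> (quat^'n) set"
  where "Psi_orbit \<Lambda> \<xi> H r q = (\<lambda>U. Psi \<Lambda> \<xi> r U q) ` H"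

end

theory Submission
  imports Defs
begin

text \<open>
  The squared norm \<open>\<Sum>\<^sub>j exp (2 t \<langle>\<lambda>\<^sub>j, \<xi>\<rangle>) |q\<^sub>j|\<^sup>2\<close> along a \<open>\<xi>\<close>-orbit has positive \<open>t\<close>-derivative, so
  the implicit function theorem makes \<open>\<tau>(0, q)\<close> smooth on the punctured space, and
  \<open>\<tau>(U, q) = \<tau>(0, \<Phi>\<^sub>U q)\<close>.  Hence \<open>\<Psi>\<^sub>U\<close> is \<open>\<Phi>\<^sub>U\<close> followed by the smooth projection \<open>\<Psi>\<^sub>0\<close> to the sphere
  along \<open>\<xi>\<close>.  As \<open>H\<close> and \<open>\<xi>\<close> span everything, a \<open>\<Psi>\<close>-orbit is a full intersection of a \<open>\<Phi>\<close>-orbit with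
  the sphere, and it is connected as a continuous image of \<open>H\<close>.  In logarithmic coordinates a
  \<open>\<Phi>\<close>-orbit is a linear space of dimension \<open>\<rho>(I)\<close>, and the leaf is a section of its quotient by the
  line of \<open>\<xi>\<close>.
\<close>

section \<open>Maps of class \<open>C\<^sup>k\<close>\<close>

text \<open>Derivatives at a point of an open set depend only on values in that set, so agreement on
  \<open>S\<close> passes to all orders.\<close>

lemma Ck_on_cong:
  assumes "open S" "\<And>x. x \<in> S \<Longrightarrow> f x = g x" "Ck_on k S f"
  shows "Ck_on k S g"
  using assms(2,3)
proof (induction k arbitrary: f g)
  case 0
  then show ?case
    by (simp cong: continuous_on_cong)
next
  case (Suc k)
  have d: "(g has_derivative frechet_derivative f (at x)) (at x)" if "x \<in> S" for x
    using Suc.prems that assms(1)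
    by (auto simp: frechet_derivative_works intro: has_derivative_transform_within_open)
  have "Ck_on k S (\<lambda>x. frechet_derivative g (at x) v)" for v
    by (rule Suc.IH[of "\<lambda>x. frechet_derivative f (at x) v"])
      (use Suc.prems frechet_derivative_at[OF d] in auto)
  then show ?case
    using d by (auto simp: differentiable_def)
qed

text \<open>Lets an explicit derivative formula stand in for
  \<open>frechet_derivative\<close>.\<close>

lemma Ck_on_SucI:
  assumes "\<And>x. x \<in> S \<Longrightarrow> (f has_derivative f' x) (at x)" "open S"
    and "\<And>v. Ck_on k S (\<lambda>x. f' x v)"
  shows "Ck_on (Suc k) S f"
proof -
  have "Ck_on k S (\<lambda>x. frechet_derivative f (at x) v)" for v
    by (rule Ck_on_cong[OF assms(2) _ assms(3)[of v]]) (metis assms(1) frechet_derivative_at)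
  then show ?thesis
    using assms(1) by (auto simp: differentiable_def)
qed

lemma Ck_on_SucD: "Ck_on (Suc k) S f \<Longrightarrow> Ck_on k S f"
proof (induction k arbitrary: f)
  case 0
  then show ?case
    by (auto intro!: differentiable_imp_continuous_on differentiable_at_imp_differentiable_on)
qed simp

lemma Ck_on_subset: "Ck_on k S f \<Longrightarrow> T \<subseteq> S \<Longrightarrow> Ck_on k T f"
  by (induction k arbitrary: f) (auto intro: continuous_on_subset)

lemma Ck_on_const: "Ck_on k S (\<lambda>x. c)"
  by (induction k arbitrary: c) auto

lemma Ck_on_bounded_linear:
  assumes "open S" "bounded_linear f"
  shows "Ck_on k S f"
proof (cases k)
  case 0
  then show ?thesis
    using assms by (simp add: linear_continuous_on)
next
  case (Suc l)
  show ?thesis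
    unfolding Suc
    by (rule Ck_on_SucI[where f' = "\<lambda>x. f"])
      (use assms in \<open>auto intro: bounded_linear_imp_has_derivative Ck_on_const\<close>)
qed

lemma Ck_on_frechet_derivative:
  "Ck_on (Suc k) S f \<Longrightarrow> x \<in> S \<Longrightarrow> (f has_derivative frechet_derivative f (at x)) (at x)"
  by (simp add: frechet_derivative_works)

lemma Ck_on_add:
  assumes "open S" "Ck_on k S f" "Ck_on k S g"
  shows "Ck_on k S (\<lambda>x. f x + g x)"
  using assms(2,3)
proof (induction k arbitrary: f g)
  case (Suc k)
  show ?case
    using Suc
    by (intro Ck_on_SucI[OF has_derivative_add[OF Ck_on_frechet_derivative
        Ck_on_frechet_derivative]] assms(1)) auto
qed (auto intro: continuous_intros)

lemma Ck_on_sum: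
  assumes "open S" "\<And>i. i \<in> A \<Longrightarrow> Ck_on k S (f i)"
  shows "Ck_on k S (\<lambda>x. \<Sum>i\<in>A. f i x)"
  using assms(2)
  by (induction A rule: infinite_finite_induct) (auto intro: Ck_on_add Ck_on_const assms(1))

text \<open>Leibniz rule: the derivative is a sum of two values of \<open>h\<close>, each with one
  factor differentiated, so the induction applies to both.\<close>

lemma Ck_on_bilinear:
  assumes "bounded_bilinear h" "open S" "Ck_on k S f" "Ck_on k S g"
  shows "Ck_on k S (\<lambda>x. h (f x) (g x))"
  using assms(3,4)
proof (induction k arbitrary: f g)
  case 0
  then show ?case
    using bounded_bilinear.continuous_on[OF assms(1)] by auto
next
  case (Suc k)
  show ?case
    by (intro Ck_on_SucI[OF bounded_bilinear.FDERIV[OF assms(1) Ck_on_frechet_derivative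
        Ck_on_frechet_derivative]] assms(2) Ck_on_add Suc.IH)
      (use Suc.prems in \<open>auto intro: Ck_on_SucD simp del: Ck_on.simps(2)\<close>, auto)
qed

lemmas Ck_on_scaleR = Ck_on_bilinear[OF bounded_bilinear_scaleR]
lemmas Ck_on_inner = Ck_on_bilinear[OF bounded_bilinear_inner]
lemmas Ck_on_mult = Ck_on_bilinear[OF bounded_bilinear_mult]

text \<open>Chain rule, by induction with \<open>f\<close> fixed and \<open>g\<close> replaced by
  its directional derivatives.\<close>

lemma Ck_on_compose:
  assumes "open S" "Ck_on k S f" "Ck_on k T g" "f ` S \<subseteq> T"
  shows "Ck_on k S (\<lambda>x. g (f x))"
  using assms(2,3)
proof (induction k arbitrary: g)
  case 0
  then show ?case
    using assms(4) by (auto intro: continuous_on_compose2)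
next
  case (Suc k)
  define f' where "f' x = frechet_derivative f (at x)" for x
  define g' where "g' y = frechet_derivative g (at y)" for y
  have g': "(g has_derivative g' (f x)) (at (f x))" if "x \<in> S" for x
    unfolding g'_def using Suc.prems assms(4) that by (blast intro: Ck_on_frechet_derivative)
  \<comment> \<open>\<open>Ck_on\<close> controls derivatives of \<open>g\<close> in fixed
    directions only, whereas \<open>f' x v\<close> moves with \<open>x\<close>; the basis expansion
    leaves fixed directions with varying coefficients.\<close>
  have sum: "g' (f x) w = (\<Sum>b\<in>Basis. (w \<bullet> b) *\<^sub>R g' (f x) b)" if "x \<in> S" for x w
  proof -
    interpret linear "g' (f x)"
      using g'[OF that] by (simp add: has_derivative_linear)
    show ?thesis
      by (subst euclidean_representation[of w, symmetric]) (simp only: sum scaleR)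
  qed
  show ?case
  proof (rule Ck_on_SucI)
    show "((\<lambda>x. g (f x)) has_derivative (\<lambda>v. g' (f x) (f' x v))) (at x)" if "x \<in> S" for x
      unfolding f'_def
      using has_derivative_compose[OF Ck_on_frechet_derivative[OF Suc.prems(1) that] g'[OF that]] .
    show "Ck_on k S (\<lambda>x. g' (f x) (f' x v))" for v
    proof (rule Ck_on_cong[OF assms(1) sum[symmetric]])
      show "Ck_on k S (\<lambda>x. \<Sum>b\<in>Basis. (f' x v \<bullet> b) *\<^sub>R g' (f x) b)"
        using Suc.prems
        by (intro Ck_on_sum Ck_on_scaleR Ck_on_inner Ck_on_const assms(1) Suc.IH)
          (auto simp: f'_def g'_def intro: Ck_on_SucD)
    qed
  qed (use assms in auto)
qed

lemma Ck_on_linear_compose: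
  assumes "bounded_linear h" "open S" "Ck_on k S f"
  shows "Ck_on k S (\<lambda>x. h (f x))"
  by (rule Ck_on_compose[OF assms(2,3) Ck_on_bounded_linear[OF open_UNIV assms(1)]]) simp

lemma Ck_on_diff:
  "open S \<Longrightarrow> Ck_on k S f \<Longrightarrow> Ck_on k S g \<Longrightarrow> Ck_on k S (\<lambda>x. f x - g x)"
  using Ck_on_add[OF _ _ Ck_on_linear_compose[OF bounded_linear_minus[OF bounded_linear_ident]],
      of S k f g] by simp

lemma Ck_on_id: "open S \<Longrightarrow> Ck_on k S (\<lambda>x. x)"
  by (simp add: Ck_on_bounded_linear bounded_linear_ident)

lemma Ck_on_Pair:
  assumes "open S" "Ck_on k S f" "Ck_on k S g"
  shows "Ck_on k S (\<lambda>x. (f x, g x))"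
proof -
  have "Ck_on k S (\<lambda>x. (f x, 0) + (0, g x))"
    using assms
    by (intro Ck_on_add Ck_on_linear_compose[where h = "\<lambda>y. (y, 0)"]
        Ck_on_linear_compose[where h = "\<lambda>y. (0, y)"] bounded_linear_Pair
        bounded_linear_ident bounded_linear_zero)
  then show ?thesis by simp
qed

lemma Ck_on_vec_lambda:
  fixes f :: "'n::finite \<Rightarrow> 'a::euclidean_space \<Rightarrow> 'b::euclidean_space"
  assumes "open S" "\<And>j. Ck_on k S (f j)"
  shows "Ck_on k S (\<lambda>x. \<chi> j. f j x)"
proof -
  have "bounded_linear (axis j :: 'b \<Rightarrow> 'b^'n)" for j
    by (rule linear_conv_bounded_linear[THEN iffD1], rule linearI)
      (auto simp: axis_def vec_eq_iff)
  then have "Ck_on k S (\<lambda>x. \<Sum>j\<in>UNIV. axis j (f j x))"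
    using assms by (intro Ck_on_sum Ck_on_linear_compose[where h = "axis _"])
  also have "(\<lambda>x. \<Sum>j\<in>UNIV. axis j (f j x)) = (\<lambda>x. \<chi> j. f j x)"
    by (simp add: fun_eq_iff vec_eq_iff axis_def)
  finally show ?thesis .
qed

lemma Ck_on_vec_nth:
  fixes f :: "'a::euclidean_space \<Rightarrow> 'b::euclidean_space^'n::finite"
  shows "open S \<Longrightarrow> Ck_on k S f \<Longrightarrow> Ck_on k S (\<lambda>x. f x $ j)"
  by (rule Ck_on_linear_compose[OF bounded_linear_vec_nth])

section \<open>Elementary real functions\<close>

lemma Ck_on_exp_real: "Ck_on k UNIV (exp :: real \<Rightarrow> real)"
proof (induction k)
  case (Suc k)
  show ?case
    by (rule Ck_on_SucI[where f' = "\<lambda>x v. v * exp x"])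
      (auto intro!: Ck_on_mult Ck_on_const Suc derivative_eq_intros)
qed (auto intro: continuous_intros)

lemma Ck_on_inverse_real: "Ck_on k (- {0}) (inverse :: real \<Rightarrow> real)"
proof (induction k)
  case (Suc k)
  show ?case
  proof (rule Ck_on_SucI[where f' = "\<lambda>x v. - v * (inverse x * inverse x)"])
    show "Ck_on k (- {0}) (\<lambda>x::real. - v * (inverse x * inverse x))" for v
      by (intro Ck_on_mult Ck_on_const Suc) auto
  qed (auto intro!: derivative_eq_intros)
qed (auto intro!: continuous_intros)

lemma Ck_on_ln_real: "Ck_on k {0<..} (ln :: real \<Rightarrow> real)"
proof (cases k)
  case (Suc l)
  show ?thesis
    unfolding Suc
    by (rule Ck_on_SucI[where f' = "\<lambda>x v. v * inverse x"])
      (auto intro!: Ck_on_mult Ck_on_const Ck_on_subset[OF Ck_on_inverse_real] derivative_eq_intros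
        simp: divide_inverse mult.commute)
qed (auto intro!: continuous_intros)

lemmas Ck_on_exp = Ck_on_compose[OF _ _ Ck_on_exp_real subset_UNIV]
lemmas Ck_on_inverse = Ck_on_compose[OF _ _ Ck_on_inverse_real]
lemmas Ck_on_ln = Ck_on_compose[OF _ _ Ck_on_ln_real]

lemma smooth_onI:
  assumes "open W" "X \<subseteq> W" "\<And>k. Ck_on k W g" "\<And>x. x \<in> X \<Longrightarrow> g x = f x"
  shows "smooth_on X f"
  unfolding smooth_on_def using assms by blast

section \<open>Implicit functions\<close>

text \<open>As \<open>G\<close> is constant on the graph of \<open>s\<close>, its linearization at
  an increment (h, k) along the graph is o(|h| + |k|). Solving for \<open>k\<close> gives - A h / B,
  and the error is then o(|h|) by absorption.\<close>

lemma implicit_has_derivative: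
  fixes G :: "'a::real_normed_vector \<times> real \<Rightarrow> real"
  assumes "open S" "x \<in> S" "isCont s x" "\<And>y. y \<in> S \<Longrightarrow> G (y, s y) = c"
    and G': "(G has_derivative G') (at (x, s x))" and nz: "G' (0, 1) \<noteq> 0"
  shows "(s has_derivative (\<lambda>h. - G' (h, 0) / G' (0, 1))) (at x)"
proof -
  define B where "B = G' (0, 1)"
  define A where "A h = G' (h, 0)" for h
  have lin: "bounded_linear G'"
    using G' by (rule has_derivative_bounded_linear)
  have blA: "bounded_linear A"
    unfolding A_def
    by (rule bounded_linear_compose[OF lin])
      (intro bounded_linear_Pair bounded_linear_ident bounded_linear_zero)
  then obtain M where M: "\<And>h. \<bar>A h\<bar> \<le> norm h * M" "M \<ge> 0"
    using bounded_linear.nonneg_bounded[OF blA] by auto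
  have split: "G' (h, k) = A h + B * k" for h k
  proof -
    interpret bounded_linear G' by (rule lin)
    have "(h, k) = (h, 0) + k *\<^sub>R (0, 1)" by simp
    then show ?thesis
      unfolding A_def B_def by (simp only: add scaleR) simp
  qed
  have B: "\<bar>B\<bar> > 0" using nz by (simp add: B_def)
  have "(s has_derivative (\<lambda>h. - A h / B)) (at x)"
    unfolding has_derivative_at_alt
  proof (intro conjI allI impI)
    show "bounded_linear (\<lambda>h. - A h / B)"
      using bounded_linear_compose[OF bounded_linear_divide bounded_linear_minus[OF blA]] .
  next
    fix e :: real assume e: "e > 0"
    \<comment> \<open>\<open>N\<close> comes from the bound |h| + |k| \<le> N |h| + R. The first
      bound on \<open>e'\<close> lets half of |B| R absorb e' R; the second turns the rest into e
      |h|.\<close>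
    define N where "N = 1 + M / \<bar>B\<bar>"
    define e' where "e' = min (\<bar>B\<bar> / 2) (e * \<bar>B\<bar> / (2 * N))"
    have N: "N > 0" using M(2) B by (simp add: N_def add_pos_nonneg)
    then have e': "e' > 0" using e B by (simp add: e'_def)
    then obtain d where d: "d > 0" "\<And>z. norm (z - (x, s x)) < d \<Longrightarrow>
        \<bar>G z - G (x, s x) - G' (z - (x, s x))\<bar> \<le> e' * norm (z - (x, s x))"
      using G' unfolding has_derivative_at_alt real_norm_def by blast
    have "\<forall>\<^sub>F y in nhds x. y \<in> S \<and> dist y x < d / 2 \<and> dist (s y) (s x) < d / 2"
      using assms(1-3) d(1) unfolding isCont_def tendsto_at_iff_tendsto_nhds
      by (intro eventually_conj eventually_nhds_in_open tendstoD filterlim_ident) auto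
    then obtain d' where d': "d' > 0" "\<And>y. dist y x < d' \<Longrightarrow>
        y \<in> S \<and> dist y x < d / 2 \<and> dist (s y) (s x) < d / 2"
      unfolding eventually_nhds_metric by blast
    show "\<exists>d>0. \<forall>y. norm (y - x) < d \<longrightarrow>
        norm (s y - s x - - A (y - x) / B) \<le> e * norm (y - x)"
    proof (intro exI[of _ d'] conjI allI impI d')
      fix y assume "norm (y - x) < d'"
      then have y: "y \<in> S" "norm (y - x) < d / 2" "\<bar>s y - s x\<bar> < d / 2"
        using d'(2)[of y] by (auto simp: dist_norm)
      define h where "h = y - x"
      define k where "k = s y - s x"
      define R where "R = \<bar>k + A h / B\<bar>"
      have n: "norm (h, k) \<le> norm h + \<bar>k\<bar>"
        using norm_Pair_le[of h k] by simp
      have z: "(y, s y) - (x, s x) = (h, k)" by (simp add: h_def k_def)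
      have "\<bar>A h + B * k\<bar> \<le> e' * norm (h, k)"
        using d(2)[of "(y, s y)"] n y assms(2,4) unfolding z split
        by (simp add: h_def k_def)
      also have "\<dots> \<le> e' * (norm h + \<bar>k\<bar>)"
        using n e' by simp
      also have "\<bar>A h + B * k\<bar> = \<bar>B\<bar> * R"
        unfolding R_def abs_mult[symmetric] using B by (simp add: algebra_simps)
      finally have 1: "\<bar>B\<bar> * R \<le> e' * (norm h + \<bar>k\<bar>)" .
      have "\<bar>k\<bar> \<le> R + \<bar>A h / B\<bar>" unfolding R_def by arith
      also have "\<bar>A h / B\<bar> \<le> norm h * M / \<bar>B\<bar>"
        using M(1)[of h] B by (simp add: abs_divide divide_right_mono)
      finally have "norm h + \<bar>k\<bar> \<le> norm h * N + R"
        by (simp add: N_def algebra_simps)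
      then have "e' * (norm h + \<bar>k\<bar>) \<le> e' * (norm h * N) + e' * R"
        using e' by (simp flip: distrib_left)
      also have "e' * R \<le> \<bar>B\<bar> / 2 * R"
        by (rule mult_right_mono) (auto simp: e'_def R_def)
      finally have "\<bar>B\<bar> / 2 * R \<le> e' * (norm h * N)"
        using 1 by simp
      also have "\<dots> \<le> e * \<bar>B\<bar> / (2 * N) * (norm h * N)"
        using N by (intro mult_right_mono) (auto simp: e'_def)
      also have "\<dots> = \<bar>B\<bar> / 2 * (e * norm h)"
        using N by simp
      finally have "R \<le> e * norm h"
        using B by simp
      then show "norm (s y - s x - - A (y - x) / B) \<le> e * norm (y - x)"
        by (simp add: R_def h_def k_def)
    qed
  qed
  then show ?thesis by (simp add: A_def B_def)
qed

text \<open>Bootstrapping: the derivative of \<open>s\<close> is expressed by \<open>s\<close> and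
  derivatives of \<open>G\<close>, so it is as smooth as \<open>s\<close>, which thereby gains one
  order.\<close>

lemma implicit_Ck_on:
  fixes G :: "'a::euclidean_space \<times> real \<Rightarrow> real"
  assumes S: "open S" and s: "continuous_on S s" "\<And>x. x \<in> S \<Longrightarrow> G (x, s x) = c"
    and G: "\<And>k. Ck_on k UNIV G"
    and nz: "\<And>x. x \<in> S \<Longrightarrow> frechet_derivative G (at (x, s x)) (0, 1) \<noteq> 0"
  shows "Ck_on k S s"
proof (induction k)
  case 0
  then show ?case using s by simp
next
  case (Suc k)
  define D where "D z v = frechet_derivative G (at z) v" for z v
  have D: "Ck_on k UNIV (\<lambda>z. D z v)" for v
    using G[of "Suc k"] unfolding D_def Ck_on.simps by blast
  have D': "Ck_on k S (\<lambda>x. D (x, s x) v)" for v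
    using Ck_on_compose[OF S Ck_on_Pair[OF S Ck_on_id[OF S] Suc] D] by simp
  show ?case
  proof (rule Ck_on_SucI)
    fix x assume x: "x \<in> S"
    have "isCont s x"
      using s(1) S x by (simp add: continuous_on_eq_continuous_at)
    then show "(s has_derivative (\<lambda>v. - D (x, s x) (v, 0) * inverse (D (x, s x) (0, 1)))) (at x)"
      using implicit_has_derivative[OF S x _ s(2) Ck_on_frechet_derivative[OF G] nz[OF x]]
      by (simp add: D_def divide_inverse)
  next
    show "Ck_on k S (\<lambda>x. - D (x, s x) (v, 0) * inverse (D (x, s x) (0, 1)))" for v
      using nz
      by (intro Ck_on_mult Ck_on_inverse D' S
          Ck_on_linear_compose[OF bounded_linear_minus[OF bounded_linear_ident]])
        (auto simp: D_def)
  qed (use S in auto)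
qed

section \<open>Projection to the sphere along \<open>\<xi>\<close>\<close>

lemma Phi_nth: "Phi \<Lambda> T q $ j = exp (\<Lambda> j \<bullet> T) *\<^sub>R q $ j"
  by (simp add: Phi_def scaleR_conv_of_real)

lemma Phi_add: "Phi \<Lambda> (S + T) q = Phi \<Lambda> S (Phi \<Lambda> T q)"
  by (simp add: vec_eq_iff Phi_nth inner_add_right exp_add)

lemma Phi_0 [simp]: "Phi \<Lambda> 0 q = q"
  by (simp add: vec_eq_iff Phi_nth)

lemma Phi_eq_0_iff [simp]: "Phi \<Lambda> T q = 0 \<longleftrightarrow> q = 0"
  by (simp add: vec_eq_iff Phi_nth)

lemma Phi_orbit_Phi: "Phi_orbit \<Lambda> (Phi \<Lambda> T q) = Phi_orbit \<Lambda> q"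
proof -
  have "Phi \<Lambda> S q = Phi \<Lambda> (S - T) (Phi \<Lambda> T q)" for S
    by (simp flip: Phi_add)
  then show ?thesis
    unfolding Phi_orbit_def by (auto simp flip: Phi_add intro: range_eqI[of _ _ "_ - T"])
qed

lemma Ck_on_Phi:
  assumes "open S" "Ck_on k S f" "Ck_on k S g"
  shows "Ck_on k S (\<lambda>x. Phi \<Lambda> (f x) (g x))"
proof -
  have "Ck_on k S (\<lambda>x. \<chi> j. exp (\<Lambda> j \<bullet> f x) *\<^sub>R g x $ j)"
    by (intro Ck_on_vec_lambda Ck_on_scaleR Ck_on_exp Ck_on_inner Ck_on_const Ck_on_vec_nth assms)
  then show ?thesis
    by (simp add: Phi_def scaleR_conv_of_real)
qed

lemma norm_Phi_power2:
  "(norm (Phi \<Lambda> T q))\<^sup>2 = (\<Sum>j\<in>UNIV. exp (2 * (\<Lambda> j \<bullet> T)) * (norm (q $ j))\<^sup>2)"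
  by (simp add: norm_vec_def L2_set_def sum_nonneg Phi_nth power_mult_distrib exp_double
      flip: power2_norm_eq_inner)

text \<open>Squared, so that it is smooth also at zeros of \<open>q\<close>, and defined on pairs to
  fit \<open>implicit_Ck_on\<close>.\<close>

definition height :: "('n::finite \<Rightarrow> quat^'m::finite) \<Rightarrow> quat^'m \<Rightarrow> (quat^'n) \<times> real \<Rightarrow> real" where
  "height \<Lambda> \<xi> = (\<lambda>(q, t). (norm (Phi \<Lambda> (t *\<^sub>R \<xi>) q))\<^sup>2)"

lemma height_eq:
  "height \<Lambda> \<xi> z = (\<Sum>j\<in>UNIV. exp (2 * (snd z * (\<Lambda> j \<bullet> \<xi>))) * (fst z $ j \<bullet> fst z $ j))"
  by (cases z) (simp add: height_def norm_Phi_power2, simp add: power2_norm_eq_inner)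

lemma Ck_on_height:
  fixes \<Lambda> :: "'n::finite \<Rightarrow> quat^'m::finite"
  shows "Ck_on k UNIV (height \<Lambda> \<xi>)"
proof -
  have "Ck_on k UNIV (\<lambda>z :: (quat^'n) \<times> real.
      \<Sum>j\<in>UNIV. exp (2 * (snd z * (\<Lambda> j \<bullet> \<xi>))) * (fst z $ j \<bullet> fst z $ j))"
    by (intro Ck_on_sum Ck_on_mult Ck_on_exp Ck_on_inner Ck_on_const Ck_on_vec_nth
        Ck_on_linear_compose[OF bounded_linear_fst] Ck_on_linear_compose[OF bounded_linear_snd]
        Ck_on_id open_UNIV)
  then show ?thesis
    by (simp add: height_eq[abs_def])
qed

lemma mem_sphere_iff_height:
  "r > 0 \<Longrightarrow> Phi \<Lambda> (t *\<^sub>R \<xi>) q \<in> sphere 0 r \<longleftrightarrow> height \<Lambda> \<xi> (q, t) = r\<^sup>2"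
  by (simp add: height_def)

text \<open>The flows of \<open>U\<close> and \<xi> commute, so the implicit function theorem is
  needed only for \<open>U = 0\<close>, with \<open>q\<close> as the sole parameter.\<close>

lemma tau_eq_tau_0: "tau \<Lambda> \<xi> r U q = tau \<Lambda> \<xi> r 0 (Phi \<Lambda> U q)"
  unfolding tau_def by (subst add.commute) (simp add: Phi_add)

lemma Psi_eq_Psi_0: "Psi \<Lambda> \<xi> r U q = Psi \<Lambda> \<xi> r 0 (Phi \<Lambda> U q)"
  unfolding Psi_def tau_eq_tau_0[of _ _ r U q]
  by (subst add.commute) (simp add: Phi_add)

section \<open>The flow along \<xi>: existence, uniqueness and smoothness of the hitting
  time\<close>

context
  fixes \<Lambda> :: "'n::finite \<Rightarrow> quat^'m::finite" and \<xi> :: "quat^'m"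
  assumes pos: "\<And>j. \<Lambda> j \<bullet> \<xi> > 0"
begin

text \<open>Every summand of \<open>height_eq\<close> is nondecreasing in time by
  \<open>pos\<close>; a nonzero coordinate makes one increase strictly.\<close>

lemma height_strict_mono:
  assumes "q \<noteq> 0" "s < t"
  shows "height \<Lambda> \<xi> (q, s) < height \<Lambda> \<xi> (q, t)"
proof -
  obtain j where "q $ j \<noteq> 0"
    using assms(1) by (auto simp: vec_eq_iff)
  then show ?thesis
    unfolding height_eq fst_conv snd_conv
    using pos assms(2)
    by (intro sum_strict_mono_ex1 ballI mult_right_mono bexI[of _ j] mult_strict_right_mono)
      (auto simp: less_imp_le)
qed

text \<open>The height tends to 0 in the past and exceeds every bound in the future, already through
  one nonzero coordinate. The intermediate value theorem gives a time, and monotonicity its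
  uniqueness.\<close>

lemma height_ex1:
  assumes q: "q \<noteq> 0" and r: "r > 0"
  shows "\<exists>!t. height \<Lambda> \<xi> (q, t) = r\<^sup>2"
proof -
  have "((\<lambda>t. \<Sum>j\<in>UNIV. exp (2 * (t * (\<Lambda> j \<bullet> \<xi>))) * (q $ j \<bullet> q $ j))
      \<longlongrightarrow> (\<Sum>j\<in>(UNIV::'n set). 0)) at_bot"
  proof (intro tendsto_sum tendsto_mult_left_zero filterlim_compose[OF exp_at_bot])
    show "LIM t at_bot. 2 * (t * (\<Lambda> j \<bullet> \<xi>)) :> at_bot" for j
      using pos[of j] filterlim_tendsto_pos_mult_at_bot[OF tendsto_const,
          of "2 * (\<Lambda> j \<bullet> \<xi>)" "\<lambda>t. t" at_bot]
      by (simp add: filterlim_ident mult_ac)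
  qed
  then have "\<forall>\<^sub>F t in at_bot. height \<Lambda> \<xi> (q, t) < r\<^sup>2"
    using r by (intro order_tendstoD(2)[of _ 0]) (auto simp: height_eq)
  then obtain a where a: "height \<Lambda> \<xi> (q, a) < r\<^sup>2"
    by (auto dest: eventually_happens)
  obtain j where j: "q $ j \<noteq> 0"
    using q by (auto simp: vec_eq_iff)
  have lim: "LIM t at_top. 2 * (t * (\<Lambda> j \<bullet> \<xi>)) :> at_top"
    using pos[of j] filterlim_tendsto_pos_mult_at_top[OF tendsto_const,
          of "2 * (\<Lambda> j \<bullet> \<xi>)" "\<lambda>t. t" at_top]
    by (simp add: filterlim_ident mult_ac)
  have "LIM t at_top. (q $ j \<bullet> q $ j) * exp (2 * (t * (\<Lambda> j \<bullet> \<xi>))) :> at_top"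
    using j by (intro filterlim_tendsto_pos_mult_at_top[OF tendsto_const]
        filterlim_compose[OF exp_at_top lim]) simp
  then have "\<forall>\<^sub>F t in at_top. r\<^sup>2 \<le> exp (2 * (t * (\<Lambda> j \<bullet> \<xi>))) * (q $ j \<bullet> q $ j)"
    by (simp add: filterlim_at_top mult.commute)
  then obtain b where "r\<^sup>2 \<le> exp (2 * (b * (\<Lambda> j \<bullet> \<xi>))) * (q $ j \<bullet> q $ j)"
    by (auto dest: eventually_happens)
  also have "\<dots> \<le> height \<Lambda> \<xi> (q, b)"
    unfolding height_eq fst_conv snd_conv by (rule member_le_sum) auto
  finally have b: "r\<^sup>2 \<le> height \<Lambda> \<xi> (q, b)" .
  have "a \<le> b"
    using a b height_strict_mono[OF q, of b a] by (cases "a \<le> b") auto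
  have "continuous_on {a..b} (\<lambda>t. height \<Lambda> \<xi> (q, t))"
    unfolding height_eq by (auto intro!: continuous_intros)
  then obtain t where "height \<Lambda> \<xi> (q, t) = r\<^sup>2"
    using IVT'[of "\<lambda>t. height \<Lambda> \<xi> (q, t)" a "r\<^sup>2" b] a b \<open>a \<le> b\<close> by auto
  then show ?thesis
    using height_strict_mono[OF q] by (metis less_irrefl linorder_neqE)
qed

lemma tau_ex1:
  assumes "q \<noteq> 0" "r > 0"
  shows "\<exists>!t. Phi \<Lambda> (U + t *\<^sub>R \<xi>) q \<in> sphere 0 r"
  using height_ex1[of "Phi \<Lambda> U q" r] assms
  by (subst add.commute, subst Phi_add) (simp only: mem_sphere_iff_height Phi_eq_0_iff not_False_eq_True)

lemma Phi_tau_in_sphere: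
  "q \<noteq> 0 \<Longrightarrow> r > 0 \<Longrightarrow> Phi \<Lambda> (U + tau \<Lambda> \<xi> r U q *\<^sub>R \<xi>) q \<in> sphere 0 r"
  unfolding tau_def by (rule theI') (rule tau_ex1)

lemma tau_eqI:
  "q \<noteq> 0 \<Longrightarrow> r > 0 \<Longrightarrow> Phi \<Lambda> (U + t *\<^sub>R \<xi>) q \<in> sphere 0 r \<Longrightarrow> tau \<Lambda> \<xi> r U q = t"
  using tau_ex1 Phi_tau_in_sphere by blast

lemma height_tau: "q \<noteq> 0 \<Longrightarrow> r > 0 \<Longrightarrow> height \<Lambda> \<xi> (q, tau \<Lambda> \<xi> r 0 q) = r\<^sup>2"
  using Phi_tau_in_sphere[of q r 0] by (simp add: mem_sphere_iff_height del: mem_sphere mem_sphere_0)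

text \<open>Restricting to the line through \<open>(q, t)\<close> in the time direction turns the
  abstract derivative into an explicit sum whose sign is visible.\<close>

lemma frechet_derivative_height:
  "frechet_derivative (height \<Lambda> \<xi>) (at (q, t)) (0, 1) =
    (\<Sum>j\<in>UNIV. 2 * (\<Lambda> j \<bullet> \<xi>) * exp (2 * (t * (\<Lambda> j \<bullet> \<xi>))) * (q $ j \<bullet> q $ j))"
proof -
  let ?D = "frechet_derivative (height \<Lambda> \<xi>) (at (q, t))"
  have 1: "(height \<Lambda> \<xi> has_derivative ?D) (at (q, t))"
    by (rule Ck_on_frechet_derivative[OF Ck_on_height UNIV_I])
  interpret bounded_linear ?D
    using 1 by (rule has_derivative_bounded_linear)
  have "((\<lambda>t. height \<Lambda> \<xi> (q, t)) has_derivative (\<lambda>v. ?D (0, v))) (at t)"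
    by (rule has_derivative_compose[of "Pair q" "Pair 0", OF _ 1])
      (intro has_derivative_Pair has_derivative_const has_derivative_ident)
  also have "(\<lambda>v. ?D (0, v)) = (\<lambda>v. ?D (0, 1) * v)"
  proof
    show "?D (0, v) = ?D (0, 1) * v" for v :: real
      using scaleR[of v "(0, 1)"] by simp
  qed
  finally have 2: "((\<lambda>t. height \<Lambda> \<xi> (q, t)) has_field_derivative ?D (0, 1)) (at t)"
    by (simp add: has_field_derivative_def)
  have "((\<lambda>t. height \<Lambda> \<xi> (q, t)) has_field_derivative
      (\<Sum>j\<in>UNIV. 2 * (\<Lambda> j \<bullet> \<xi>) * exp (2 * (t * (\<Lambda> j \<bullet> \<xi>))) * (q $ j \<bullet> q $ j))) (at t)"
    unfolding height_eq by (auto intro!: derivative_eq_intros sum.cong)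
  then show ?thesis
    using 2 DERIV_unique by blast
qed

text \<open>By monotonicity, \<open>tau\<close> exceeds \<open>a\<close> exactly when the height at
  time \<open>a\<close> is below \<open>r\<^sup>2\<close>, an open condition on the point; likewise
  for the reverse inequality.\<close>

lemma continuous_on_tau_0:
  assumes "r > 0"
  shows "continuous_on (- {0}) (tau \<Lambda> \<xi> r 0)"
  unfolding continuous_on_def
proof (intro ballI order_tendstoI)
  fix x :: "quat^'n" assume x: "x \<in> - {0}"
  have H: "((\<lambda>y. height \<Lambda> \<xi> (y, a)) \<longlongrightarrow> height \<Lambda> \<xi> (x, a)) (at x within - {0})" for a
    unfolding height_eq by (auto intro!: tendsto_intros)
  have nz: "\<forall>\<^sub>F y in at x within - {0}. y \<in> - {0}"
    by (simp add: eventually_at_filter)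
  {
    fix a assume "a < tau \<Lambda> \<xi> r 0 x"
    then have "height \<Lambda> \<xi> (x, a) < r\<^sup>2"
      using x height_strict_mono height_tau[OF _ assms] by force
    from order_tendstoD(2)[OF H this] nz
    show "\<forall>\<^sub>F y in at x within - {0}. a < tau \<Lambda> \<xi> r 0 y"
    proof eventually_elim
      case (elim y)
      then show ?case
        using height_strict_mono[of y "tau \<Lambda> \<xi> r 0 y" a] height_tau[of y, OF _ assms]
        by (cases a "tau \<Lambda> \<xi> r 0 y" rule: linorder_cases) auto
    qed
  next
    fix a assume "a > tau \<Lambda> \<xi> r 0 x"
    then have "height \<Lambda> \<xi> (x, a) > r\<^sup>2"
      using x height_strict_mono height_tau[OF _ assms] by force
    from order_tendstoD(1)[OF H this] nz
    show "\<forall>\<^sub>F y in at x within - {0}. a > tau \<Lambda> \<xi> r 0 y"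
    proof eventually_elim
      case (elim y)
      then show ?case
        using height_strict_mono[of y a "tau \<Lambda> \<xi> r 0 y"] height_tau[of y, OF _ assms]
        by (cases a "tau \<Lambda> \<xi> r 0 y" rule: linorder_cases) auto
    qed
  }
qed

text \<open>The time derivative of the height is a sum of nonnegative terms, positive at a nonzero
  coordinate, so the implicit function theorem applies on the whole punctured space.\<close>

lemma Ck_on_tau_0:
  assumes "r > 0"
  shows "Ck_on k (- {0}) (tau \<Lambda> \<xi> r 0)"
proof (rule implicit_Ck_on[OF _ continuous_on_tau_0[OF assms] height_tau[OF _ assms] Ck_on_height])
  fix q :: "quat^'n" assume "q \<in> - {0}"
  then obtain j where j: "q $ j \<noteq> 0"
    by (auto simp: vec_eq_iff)
  then show "frechet_derivative (height \<Lambda> \<xi>) (at (q, tau \<Lambda> \<xi> r 0 q)) (0, 1) \<noteq> 0"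
    unfolding frechet_derivative_height
    using pos
    by (intro less_imp_neq[THEN not_sym] sum_pos2[where i = j]) (auto simp: less_imp_le)
qed auto

section \<open>The induced action on the sphere and its orbits\<close>

lemma Ck_on_Psi:
  assumes "r > 0" "open S" "Ck_on k S f" "Ck_on k S g" "\<And>x. x \<in> S \<Longrightarrow> g x \<noteq> 0"
  shows "Ck_on k S (\<lambda>x. Psi \<Lambda> \<xi> r (f x) (g x))"
proof -
  have Phi: "Ck_on k S (\<lambda>x. Phi \<Lambda> (f x) (g x))"
    using assms by (intro Ck_on_Phi)
  have "Ck_on k S (\<lambda>x. Phi \<Lambda> (tau \<Lambda> \<xi> r 0 (Phi \<Lambda> (f x) (g x)) *\<^sub>R \<xi>) (Phi \<Lambda> (f x) (g x)))"
    by (intro Ck_on_Phi Ck_on_scaleR Ck_on_const Ck_on_compose[OF assms(2) Phi Ck_on_tau_0] Phi)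
      (use assms in auto)
  moreover have "Phi \<Lambda> (tau \<Lambda> \<xi> r 0 (Phi \<Lambda> (f x) (g x)) *\<^sub>R \<xi>) (Phi \<Lambda> (f x) (g x)) =
      Psi \<Lambda> \<xi> r (f x) (g x)" for x
    by (subst Psi_eq_Psi_0) (simp add: Psi_def)
  ultimately show ?thesis
    by simp
qed

text \<open>A shift of \<open>U\<close> along \<xi> is undone by \<open>tau\<close>, so
  \<open>Psi\<close> depends only on \<open>U\<close> modulo the line of \<xi>.\<close>

lemma Psi_add_scaleR:
  assumes "q \<noteq> 0" "r > 0"
  shows "Psi \<Lambda> \<xi> r (U + t *\<^sub>R \<xi>) q = Psi \<Lambda> \<xi> r U q"
proof -
  have "tau \<Lambda> \<xi> r (U + t *\<^sub>R \<xi>) q = tau \<Lambda> \<xi> r U q - t"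
    using Phi_tau_in_sphere[OF assms, of U]
    by (intro tau_eqI assms) (simp add: scaleR_diff_left del: mem_sphere mem_sphere_0)
  then show ?thesis
    by (simp add: Psi_def scaleR_diff_left)
qed

lemma Psi_mem_sphere: "q \<noteq> 0 \<Longrightarrow> r > 0 \<Longrightarrow> Psi \<Lambda> \<xi> r U q \<in> sphere 0 r"
  unfolding Psi_def by (rule Phi_tau_in_sphere)

lemma Psi_eq_Phi:
  "q \<noteq> 0 \<Longrightarrow> r > 0 \<Longrightarrow> Phi \<Lambda> T q \<in> sphere 0 r \<Longrightarrow> Psi \<Lambda> \<xi> r T q = Phi \<Lambda> T q"
  using tau_eqI[of q r T 0] by (simp add: Psi_def)

lemma smooth_action_Psi:
  assumes r: "r > 0"
  shows "smooth_action H (sphere 0 r) (Psi \<Lambda> \<xi> r)"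
  unfolding smooth_action_def
proof (intro conjI ballI)
  show "smooth_on (H \<times> sphere 0 r) (\<lambda>(U, q). Psi \<Lambda> \<xi> r U q)"
  proof (rule smooth_onI)
    \<comment> \<open>The extension demanded by \<open>smooth_on\<close>: \<open>Psi\<close> is
      smooth for all \<open>U\<close> and all nonzero \<open>q\<close>.\<close>
    have o: "open (UNIV \<times> - {0} :: ((quat^'m) \<times> (quat^'n)) set)"
      by (intro open_Times) auto
    then show "Ck_on k (UNIV \<times> - {0}) (\<lambda>z. Psi \<Lambda> \<xi> r (fst z) (snd z))" for k
      by (intro Ck_on_Psi r Ck_on_bounded_linear bounded_linear_fst bounded_linear_snd) auto
    show "open (UNIV \<times> - {0} :: ((quat^'m) \<times> (quat^'n)) set)"
      by (rule o)
  qed (use r in auto)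
next
  fix U V and q :: "quat^'n"
  assume "q \<in> sphere 0 r"
  then have q: "q \<noteq> 0" using r by auto
  show "Psi \<Lambda> \<xi> r U q \<in> sphere 0 r"
    by (rule Psi_mem_sphere[OF q r])
  show "Psi \<Lambda> \<xi> r 0 q = q"
    using Psi_eq_Phi[OF q r, of 0] \<open>q \<in> sphere 0 r\<close> by simp
  \<comment> \<open>Composing leaves a surplus multiple of \<xi> in the parameter, which
    \<open>Psi_add_scaleR\<close> discards.\<close>
  have "Psi \<Lambda> \<xi> r U (Psi \<Lambda> \<xi> r V q) =
      Psi \<Lambda> \<xi> r 0 (Phi \<Lambda> (U + V + tau \<Lambda> \<xi> r V q *\<^sub>R \<xi>) q)"
    by (simp add: Psi_eq_Psi_0[of _ _ r U]) (simp add: Psi_def add.assoc flip: Phi_add)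
  also have "\<dots> = Psi \<Lambda> \<xi> r (U + V) q"
    by (simp add: Psi_add_scaleR[OF q r] flip: Psi_eq_Psi_0)
  finally show "Psi \<Lambda> \<xi> r (U + V) q = Psi \<Lambda> \<xi> r U (Psi \<Lambda> \<xi> r V q)" ..
qed

text \<open>For the harder inclusion, a point \<open>Phi \<Lambda> T q\<close> on the sphere equals
  \<open>Psi \<Lambda> \<xi> r T q\<close>; dropping the \<xi>-part of \<open>T\<close> leaves a
  parameter in \<open>H\<close>.\<close>

lemma Psi_orbit_eq:
  assumes "r > 0" "q \<noteq> 0" and H: "\<And>T. \<exists>U\<in>H. \<exists>t. T = U + t *\<^sub>R \<xi>"
  shows "Psi_orbit \<Lambda> \<xi> H r q = Phi_orbit \<Lambda> q \<inter> sphere 0 r"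
proof (intro equalityI subsetI)
  fix x assume "x \<in> Psi_orbit \<Lambda> \<xi> H r q"
  then show "x \<in> Phi_orbit \<Lambda> q \<inter> sphere 0 r"
    using Psi_mem_sphere[OF assms(2,1)]
    by (auto simp: Psi_orbit_def Phi_orbit_def Psi_def)
next
  fix x assume x: "x \<in> Phi_orbit \<Lambda> q \<inter> sphere 0 r"
  then obtain T where T: "x = Phi \<Lambda> T q"
    by (auto simp: Phi_orbit_def)
  obtain U t where "U \<in> H" "T = U + t *\<^sub>R \<xi>"
    using H by blast
  moreover have "x = Psi \<Lambda> \<xi> r T q"
    using Psi_eq_Phi[of q r T] x T assms by simp
  ultimately show "x \<in> Psi_orbit \<Lambda> \<xi> H r q"
    using Psi_add_scaleR[OF assms(2,1)] by (auto simp: Psi_orbit_def)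
qed

lemma connected_Psi_orbit:
  assumes "r > 0" "q \<noteq> 0" "convex H"
  shows "connected (Psi_orbit \<Lambda> \<xi> H r q)"
proof -
  have "Ck_on 0 UNIV (\<lambda>U. Psi \<Lambda> \<xi> r U q)"
    using assms by (intro Ck_on_Psi Ck_on_id Ck_on_const) auto
  then have "continuous_on H (\<lambda>U. Psi \<Lambda> \<xi> r U q)"
    by (auto intro: continuous_on_subset)
  then show ?thesis
    unfolding Psi_orbit_def using assms(3) by (intro connected_continuous_image convex_connected)
qed

text \<open>Each intersection is a single connected \<Psi>-orbit, hence its own only
  component.\<close>

lemma Psi_orbits_eq_components:
  assumes r: "r > 0" and "subspace H" and H: "\<And>T. \<exists>U\<in>H. \<exists>t. T = U + t *\<^sub>R \<xi>"
  shows "{Psi_orbit \<Lambda> \<xi> H r q | q. q \<in> sphere 0 r} =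
    {C. \<exists>x. x \<noteq> 0 \<and> C \<in> components (Phi_orbit \<Lambda> x \<inter> sphere 0 r)}"
proof -
  have comp: "components (Phi_orbit \<Lambda> q \<inter> sphere 0 r) = {Psi_orbit \<Lambda> \<xi> H r q}"
    if "q \<noteq> 0" for q
  proof -
    have "Psi_orbit \<Lambda> \<xi> H r q \<noteq> {}"
      using subspace_0[OF assms(2)] by (auto simp: Psi_orbit_def)
    then show ?thesis
      using connected_Psi_orbit[OF r that subspace_imp_convex[OF assms(2)]]
      by (simp add: components_eq_sing_iff Psi_orbit_eq[OF r that H])
  qed
  \<comment> \<open>Base points may be any nonzero vectors on the right but lie on the sphere on the
    left; sliding along \<xi> reaches the sphere within the same \<Phi>-orbit.\<close>
  have "\<exists>y\<in>sphere 0 r. Psi_orbit \<Lambda> \<xi> H r x = Psi_orbit \<Lambda> \<xi> H r y" if x: "x \<noteq> 0" for x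
  proof (rule bexI)
    show y: "Psi \<Lambda> \<xi> r 0 x \<in> sphere 0 r" by (rule Psi_mem_sphere[OF x r])
    then have "Psi \<Lambda> \<xi> r 0 x \<noteq> 0" using r by auto
    moreover have "Phi_orbit \<Lambda> (Psi \<Lambda> \<xi> r 0 x) = Phi_orbit \<Lambda> x"
      by (simp add: Psi_def Phi_orbit_Phi)
    ultimately show "Psi_orbit \<Lambda> \<xi> H r x = Psi_orbit \<Lambda> \<xi> H r (Psi \<Lambda> \<xi> r 0 x)"
      by (simp add: Psi_orbit_eq[OF r _ H] x)
  qed
  moreover have "x \<noteq> 0" if "x \<in> sphere 0 r" for x :: "quat^'n"
    using that r by auto
  ultimately have "C \<in> {Psi_orbit \<Lambda> \<xi> H r q | q. q \<in> sphere 0 r} \<longleftrightarrow>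
      (\<exists>x. x \<noteq> 0 \<and> C = Psi_orbit \<Lambda> \<xi> H r x)" for C
    by blast
  then show ?thesis
    using comp by (auto simp del: mem_sphere mem_sphere_0)
qed

end

section \<open>Charts of the leaves\<close>

text \<open>Real coordinates are stored as real quaternions, so that the range lies in the ambient
  space of the leaf, as \<open>diffeomorphic_Rn\<close> requires.\<close>

definition weight_map :: "('n::finite \<Rightarrow> quat^'m::finite) \<Rightarrow> 'n set \<Rightarrow> quat^'m \<Rightarrow> quat^'n" where
  "weight_map \<Lambda> I T = (\<chi> j. if j \<in> I then (\<Lambda> j \<bullet> T) *\<^sub>R 1 else 0)"

lemma linear_weight_map: "linear (weight_map \<Lambda> I)"
  by (rule linearI) (auto simp: weight_map_def vec_eq_iff inner_add_right scaleR_add_left)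

lemma dim_range_weight_map: "dim (range (weight_map \<Lambda> I)) = rho \<Lambda> I"
proof -
  let ?L = "weight_map \<Lambda> I" and ?S = "span (\<Lambda> ` I)"
  have 0: "?L T = 0 \<longleftrightarrow> (\<forall>j\<in>I. orthogonal T (\<Lambda> j))" for T
    by (auto simp: weight_map_def vec_eq_iff orthogonal_def inner_commute)
  have "inj_on ?L ?S"
    unfolding linear_injective_on_subspace_0[OF linear_weight_map subspace_span]
    using 0 orthogonal_to_span[of _ "\<Lambda> ` I"] by (force simp: orthogonal_self)
  then have "dim (?L ` ?S) = rho \<Lambda> I"
    using dim_image_eq[OF linear_weight_map, where S = ?S] by (simp add: rho_def span_span)
  moreover have "range ?L \<subseteq> ?L ` ?S"
  proof
    fix v assume "v \<in> range ?L"
    then obtain T where T: "v = ?L T" by blast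
    obtain y z where yz: "y \<in> ?S" "\<And>w. w \<in> ?S \<Longrightarrow> orthogonal z w" "T = y + z"
      using orthogonal_subspace_decomp_exists[of "\<Lambda> ` I" T] by metis
    then have "?L z = 0"
      unfolding 0 by (simp add: span_base)
    then show "v \<in> ?L ` ?S"
      using yz by (simp add: T linear_add[OF linear_weight_map])
  qed
  ultimately show ?thesis
    by (metis antisym image_mono subset_UNIV)
qed

text \<open>In the coordinates \<open>ln (norm (x $ j) / norm (q $ j))\<close>, \<open>j \<in> I\<close>, the \<open>\<Phi>\<close>-orbit of \<open>q\<close> is the
  range of \<open>weight_map\<close>, and sliding along \<open>\<xi>\<close> is translation by \<open>weight_map \<Lambda> I \<xi>\<close>.  The leaf meets
  every such line exactly once, so the orthogonal projection along this vector is a global chart.\<close>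

lemma diffeomorphic_leaf:
  fixes \<Lambda> :: "'n::finite \<Rightarrow> quat^'m::finite" and q :: "quat^'n"
  assumes pos: "\<And>j. \<Lambda> j \<bullet> \<xi> > 0" and q: "q \<in> E_star I" "q \<noteq> 0" and r: "r > 0"
  shows "diffeomorphic (Phi_orbit \<Lambda> q \<inter> sphere 0 r)
    {v \<in> range (weight_map \<Lambda> I). v \<bullet> weight_map \<Lambda> I \<xi> = 0}"
    (is "diffeomorphic ?X ?V")
proof -
  let ?L = "weight_map \<Lambda> I"
  define e where "e = ?L \<xi>"
  define \<pi> where "\<pi> v = v - ((v \<bullet> e) * inverse (e \<bullet> e)) *\<^sub>R e" for v
  \<comment> \<open>Half the logarithm of the ratio of squared norms: the logarithm of the norm
    ratio, written with inner products so that the rules for \<open>Ck_on\<close> apply.\<close>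
  define lg :: "quat^'n \<Rightarrow> quat^'n" where "lg x = (\<chi> j. if j \<in> I
      then ((ln (x $ j \<bullet> x $ j) - ln (q $ j \<bullet> q $ j)) * inverse 2) *\<^sub>R 1 else 0)" for x
  \<comment> \<open>Inverse of \<open>lg\<close> on the \<Phi>-orbit: the inner product with 1 reads
    off the real part, and coordinates outside \<open>I\<close> vanish with those of
    \<open>q\<close>.\<close>
  define ex :: "quat^'n \<Rightarrow> quat^'n" where "ex v = (\<chi> j. exp (v $ j \<bullet> 1) *\<^sub>R q $ j)" for v
  have qI: "j \<in> I \<longleftrightarrow> q $ j \<noteq> 0" for j
    using q(1) by (auto simp: E_star_def)
  obtain i where i: "i \<in> I"
    using q(2) qI by (auto simp: vec_eq_iff)
  have "e $ i \<noteq> 0"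
    using i pos[of i] by (simp add: e_def weight_map_def)
  then have e: "e \<noteq> 0" by auto
  have lg: "lg (Phi \<Lambda> T q) = ?L T" for T
    by (auto simp: lg_def weight_map_def vec_eq_iff Phi_nth qI ln_mult)
  have ex: "ex (?L T) = Phi \<Lambda> T q" for T
    using qI by (auto simp: ex_def weight_map_def vec_eq_iff Phi_nth inner_quat_def)
  \<comment> \<open>Projecting along \<open>e\<close> amounts to shifting the parameter along
    \<xi>.\<close>
  have \<pi>: "\<pi> (?L T) = ?L (T - ((?L T \<bullet> e) * inverse (e \<bullet> e)) *\<^sub>R \<xi>)" for T
    by (simp add: \<pi>_def e_def linear_diff[OF linear_weight_map] linear_cmul[OF linear_weight_map])
  have \<pi>e: "\<pi> v \<bullet> e = 0" for v
    using e by (simp add: \<pi>_def inner_diff_left)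
  have "smooth_on ?X (\<lambda>x. \<pi> (lg x))"
  proof (rule smooth_onI)
    let ?W = "\<Inter>j\<in>I. {x :: quat^'n. x $ j \<noteq> 0}"
    show W: "open ?W"
      by (intro open_INT ballI open_Collect_neq continuous_intros) simp
    show "?X \<subseteq> ?W"
      using qI by (auto simp: Phi_orbit_def Phi_nth)
    have comp: "Ck_on k ?W (\<lambda>x. if j \<in> I
        then ((ln (x $ j \<bullet> x $ j) - ln (q $ j \<bullet> q $ j)) * inverse 2) *\<^sub>R (1::quat) else 0)" for k j
    proof (cases "j \<in> I")
      case True
      have "Ck_on k ?W (\<lambda>x. ((ln (x $ j \<bullet> x $ j) - ln (q $ j \<bullet> q $ j)) * inverse 2) *\<^sub>R (1::quat))"
        by (intro Ck_on_scaleR Ck_on_mult Ck_on_diff Ck_on_const Ck_on_ln Ck_on_inner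
            Ck_on_vec_nth Ck_on_id W) (use True in auto)
      then show ?thesis using True by simp
    qed (simp add: Ck_on_const)
    have "Ck_on k ?W lg" for k
      unfolding lg_def[abs_def] by (intro Ck_on_vec_lambda W comp)
    then show "Ck_on k ?W (\<lambda>x. \<pi> (lg x))" for k
      unfolding \<pi>_def by (intro Ck_on_diff Ck_on_scaleR Ck_on_mult Ck_on_inner Ck_on_const W)
  qed simp
  moreover have "smooth_on ?V (\<lambda>v. Psi \<Lambda> \<xi> r 0 (ex v))"
  proof (rule smooth_onI[of UNIV])
    have "Ck_on k UNIV ex" for k
      unfolding ex_def[abs_def]
      by (intro Ck_on_vec_lambda Ck_on_scaleR Ck_on_exp Ck_on_inner Ck_on_vec_nth Ck_on_id
          Ck_on_const open_UNIV)
    moreover have "ex v \<noteq> 0" for v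
      using q(2) by (auto simp: ex_def vec_eq_iff)
    ultimately show "Ck_on k UNIV (\<lambda>v. Psi \<Lambda> \<xi> r 0 (ex v))" for k
      by (intro Ck_on_Psi[of \<Lambda> \<xi>] pos r Ck_on_const open_UNIV)
  qed auto
  moreover have "Psi \<Lambda> \<xi> r 0 (ex v) \<in> ?X" "\<pi> (lg (Psi \<Lambda> \<xi> r 0 (ex v))) = v" if v: "v \<in> ?V" for v
  proof -
    obtain T where T: "v = ?L T" "v \<bullet> e = 0"
      using v by (auto simp: e_def)
    define S where "S = T + tau \<Lambda> \<xi> r T q *\<^sub>R \<xi>"
    have S: "Psi \<Lambda> \<xi> r 0 (ex v) = Phi \<Lambda> S q"
      by (simp add: T(1) ex flip: Psi_eq_Psi_0) (simp add: Psi_def S_def)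
    then show "Psi \<Lambda> \<xi> r 0 (ex v) \<in> ?X"
      using Phi_tau_in_sphere[of \<Lambda> \<xi>, OF pos q(2) r, of T] by (simp add: Phi_orbit_def S_def)
    \<comment> \<open>The correction by \<open>tau\<close> is a multiple of \<open>e\<close>, which
      \<pi> removes, while \<open>v\<close> is already orthogonal to \<open>e\<close>.\<close>
    have "?L S = v + tau \<Lambda> \<xi> r T q *\<^sub>R e"
      by (simp add: S_def T(1) e_def linear_add[OF linear_weight_map]
          linear_cmul[OF linear_weight_map])
    then show "\<pi> (lg (Psi \<Lambda> \<xi> r 0 (ex v))) = v"
      using T(2) e by (simp add: S lg \<pi>_def inner_add_left)
  qed
  moreover have "\<pi> (lg x) \<in> ?V" "Psi \<Lambda> \<xi> r 0 (ex (\<pi> (lg x))) = x" if x: "x \<in> ?X" for x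
  proof -
    obtain T where T: "x = Phi \<Lambda> T q" "Phi \<Lambda> T q \<in> sphere 0 r"
      using x by (auto simp: Phi_orbit_def)
    define c where "c = (?L T \<bullet> e) * inverse (e \<bullet> e)"
    show "\<pi> (lg x) \<in> ?V"
      using \<pi>e[of "?L T"] \<pi>[of T] by (auto simp: T lg e_def)
    \<comment> \<open>The projection has changed \<open>T\<close> only by a multiple of \<xi>, which
      \<open>Psi\<close> does not see.\<close>
    have "Psi \<Lambda> \<xi> r 0 (ex (\<pi> (lg x))) = Psi \<Lambda> \<xi> r (T + (- c) *\<^sub>R \<xi>) q"
      by (simp add: T lg \<pi> ex c_def flip: Psi_eq_Psi_0)
    also have "\<dots> = x"
      by (simp only: Psi_add_scaleR[of \<Lambda> \<xi>, OF pos q(2) r] Psi_eq_Phi[of \<Lambda> \<xi>, OF pos q(2) r T(2)] T(1))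
    finally show "Psi \<Lambda> \<xi> r 0 (ex (\<pi> (lg x))) = x" .
  qed
  ultimately show ?thesis
    unfolding diffeomorphic_def
    by (intro exI[of _ "\<lambda>x. \<pi> (lg x)"] exI[of _ "\<lambda>v. Psi \<Lambda> \<xi> r 0 (ex v)"] conjI ballI) auto
qed

text \<open>The image of \<xi> is nonzero, having positive coordinates on \<open>I\<close>, so its
  orthogonal complement in the range loses exactly one dimension. The sum formula also shows that
  the natural subtraction does not truncate.\<close>

lemma leaf_model:
  assumes pos: "\<And>j. \<Lambda> j \<bullet> \<xi> > 0" and "I \<noteq> {}"
  shows "subspace {v \<in> range (weight_map \<Lambda> I). v \<bullet> weight_map \<Lambda> I \<xi> = 0}"
    and "dim {v \<in> range (weight_map \<Lambda> I). v \<bullet> weight_map \<Lambda> I \<xi> = 0} = rho \<Lambda> I - 1"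
proof -
  let ?R = "range (weight_map \<Lambda> I)"
  define e where "e = weight_map \<Lambda> I \<xi>"
  obtain i where "i \<in> I" using assms(2) by auto
  then have "e $ i \<noteq> 0"
    using pos[of i] by (simp add: e_def weight_map_def)
  then have e: "e \<noteq> 0" by auto
  have R: "subspace ?R"
    by (rule linear_subspace_image[OF linear_weight_map subspace_UNIV])
  have "{v \<in> ?R. v \<bullet> e = 0} = ?R \<inter> {v. e \<bullet> v = 0}"
    by (auto simp only: inner_commute[of e])
  then show "subspace {v \<in> ?R. v \<bullet> weight_map \<Lambda> I \<xi> = 0}"
    unfolding e_def[symmetric] by (simp only: subspace_inter[OF R subspace_hyperplane])
  have "span {e} \<subseteq> ?R"
    by (intro span_minimal R) (simp add: e_def)
  from dim_subspace_orthogonal_to_vectors[OF subspace_span R this]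
  have "dim {y \<in> ?R. \<forall>x\<in>span {e}. orthogonal x y} + dim (span {e}) = rho \<Lambda> I"
    unfolding dim_range_weight_map .
  moreover have "(\<forall>x\<in>span {e}. orthogonal x y) \<longleftrightarrow> y \<bullet> e = 0" for y
    unfolding span_singleton orthogonal_def inner_commute[of y e] by auto
  moreover have "dim (span {e}) = 1"
    using e by simp
  ultimately show "dim {v \<in> ?R. v \<bullet> weight_map \<Lambda> I \<xi> = 0} = rho \<Lambda> I - 1"
    unfolding e_def[symmetric] by simp
qed

text \<open>A global chart serves at every point, with \<open>X\<close> itself as the
  neighbourhood.\<close>

lemma smooth_submanifold_of_diffeomorphic:
  fixes X V :: "'a::euclidean_space set"
  assumes "subspace V" "dim V = k" "diffeomorphic X V"
  shows "smooth_submanifold X k"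
  unfolding smooth_submanifold_def
  by (rule ballI, rule exI[of _ X]) (use assms openin_subtopology_self in blast)

theorem theorem15p5:
  fixes \<Lambda> :: "'n::finite \<Rightarrow> quat^'m::finite"
    and \<xi> :: "quat^'m"
    and H :: "(quat^'m) set"
    and r :: real
  assumes "0 \<notin> convex hull (range \<Lambda>)"
    and "\<forall>j. \<Lambda> j \<bullet> \<xi> > 0"
    and "real_hyperplane H"
    and "\<forall>T. \<exists>!(U, t). U \<in> H \<and> T = U + t *\<^sub>R \<xi>"
    and "r > 0"
  shows "(\<forall>U\<in>H. \<forall>q\<in>sphere (0 :: quat^'n) r. \<exists>!t. Phi \<Lambda> (U + t *\<^sub>R \<xi>) q \<in> sphere 0 r) \<and>
    smooth_action H (sphere (0 :: quat^'n) r) (Psi \<Lambda> \<xi> r) \<and>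
    {Psi_orbit \<Lambda> \<xi> H r q | q. q \<in> sphere 0 r} =
      {C. \<exists>x. x \<noteq> 0 \<and> C \<in> components (Phi_orbit \<Lambda> x \<inter> sphere 0 r)} \<and>
    (\<forall>I. \<forall>q \<in> E_star I \<inter> sphere 0 r.
      smooth_submanifold (Psi_orbit \<Lambda> \<xi> H r q) (rho \<Lambda> I - 1) \<and>
      diffeomorphic_Rn (Psi_orbit \<Lambda> \<xi> H r q) (rho \<Lambda> I - 1))"
proof (intro conjI allI ballI)
  have pos: "\<And>j. \<Lambda> j \<bullet> \<xi> > 0" and sub: "subspace H"
    using assms by (auto simp: real_hyperplane_def)
  have H: "\<exists>U\<in>H. \<exists>t. T = U + t *\<^sub>R \<xi>" for T
    using assms(4)[rule_format, of T] by auto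
  have nz: "q \<noteq> 0" if "q \<in> sphere 0 r" for q :: "quat^'n"
    using that \<open>r > 0\<close> by auto
  show "\<exists>!t. Phi \<Lambda> (U + t *\<^sub>R \<xi>) q \<in> sphere 0 r" if "q \<in> sphere 0 r" for U q
    by (rule tau_ex1[of \<Lambda> \<xi>, OF pos nz[OF that] \<open>r > 0\<close>])
  show "smooth_action H (sphere (0 :: quat^'n) r) (Psi \<Lambda> \<xi> r)"
    by (rule smooth_action_Psi[of \<Lambda> \<xi>, OF pos \<open>r > 0\<close>])
  show "{Psi_orbit \<Lambda> \<xi> H r q | q. q \<in> sphere 0 r} =
      {C. \<exists>x. x \<noteq> 0 \<and> C \<in> components (Phi_orbit \<Lambda> x \<inter> sphere 0 r)}"
    by (rule Psi_orbits_eq_components[of \<Lambda> \<xi>, OF pos \<open>r > 0\<close> sub H])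
  fix I and q :: "quat^'n" assume q: "q \<in> E_star I \<inter> sphere 0 r"
  then have "q \<noteq> 0" using nz by blast
  then have "I \<noteq> {}"
    using q by (auto simp: E_star_def vec_eq_iff)
  note model = leaf_model[of \<Lambda> \<xi>, OF pos this]
  \<comment> \<open>The leaf is the full intersection of the \<Phi>-orbit with the sphere, which is
    where the logarithmic chart is defined.\<close>
  have "diffeomorphic (Psi_orbit \<Lambda> \<xi> H r q)
      {v \<in> range (weight_map \<Lambda> I). v \<bullet> weight_map \<Lambda> I \<xi> = 0}"
    using diffeomorphic_leaf[of \<Lambda> \<xi> q I r] q \<open>q \<noteq> 0\<close> \<open>r > 0\<close> pos
    by (simp add: Psi_orbit_eq[of \<Lambda> \<xi>, OF pos \<open>r > 0\<close> \<open>q \<noteq> 0\<close> H])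
  with model show "smooth_submanifold (Psi_orbit \<Lambda> \<xi> H r q) (rho \<Lambda> I - 1)"
    "diffeomorphic_Rn (Psi_orbit \<Lambda> \<xi> H r q) (rho \<Lambda> I - 1)"
    by (auto intro: smooth_submanifold_of_diffeomorphic simp: diffeomorphic_Rn_def)
qed

end
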